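(* Let $\mathcal{D}_R=(K,w'_{e'},p'_{e'})_{e'\in E'}$ be a random dynamical system on a complete metric space $(K,d)$ with a Markov partition $(K_j)_{j\in N}$ such that the resulting Markov system $\mathcal{M}=(K_{i(e)},w_e,p_e)_{e\in E}$ is countable. Suppose $\mathcal{D}_R$ is continuous, and $\mathcal{M}$ is uniformly continuous and has a dominating Markov chain. Then $\mathcal{M}$ is consistent.
   Context: $(K,d)$ is a complete metric space; $P(X)$ denotes the Borel probability measures on $X$. A random dynamical system $(K,w'_{e'},p'_{e'})_{e'\in E'}$ consists of an at most countable set $E'$ and Borel maps $w'_{e'}:K\to K$, $p'_{e'}:K\to[0,1]$ with $\sum_{e'\in E'}p'_{e'}(x)=1$ for all $x\in K$; it is continuous iff all $w'_{e'}$ and $p'_{e'}$ are continuous on $K$. A countable Markov system $\mathcal{M}=(K_{i(e)},w_e,p_e)_{e\in E}$ on $K$ consists of: a set $N\subset\mathbb{N}$ with $1\in N$; a partition $(K_j)_{j\in N}$ of $K$ into non-empty Borel sets; an at most countable set $E$; a surjective map $i:E\to N$ and a map $t:E\to N$; for each $e\in E$, Borel measurable $w_e:K_{i(e)}\to K_{t(e)}$ and $p_e:K_{i(e)}\to[0,1]$ with $p_e\not\equiv0$, such that $\sum_{e\in E,\,i(e)=j}p_e(x)=1$ for all $x\in K_j$, $j\in N$. Each $p_e$ is extended to $K$ by zero and each $w_e$ to a Borel map $K\to K$ arbitrarily. A partition $(K_j)_{j\in N}$ of $K$ into non-empty Borel sets is a Markov partition of $\mathcal{D}_R$ iff the restrictions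 of its maps and probability functions to the atoms form (after re-indexing) a Markov system: $E$ indexes the pairs $(e',j)\in E'\times N$ with $p'_{e'}|_{K_j}\not\equiv0$; for $e\in E$ corresponding to $(e',j)$ one has $i(e)=j$, $w_e|_{K_j}=w'_{e'}|_{K_j}$, $p_e|_{K_j}=p'_{e'}|_{K_j}$, and $w'_{e'}(K_j)\subset K_{t(e)}$. This is the resulting Markov system. For Borel $f:K\to[0,\infty)$, $Uf:=\sum_{e\in E}p_e\,f\circ w_e$; $U^*\nu(f):=\int Uf\,d\nu$ for bounded such $f$; $P(\mathcal{M}):=\{\mu\in P(K):U^*\mu=\mu\}$. $\mathcal{M}$ is uniformly continuous iff $w_e|_{K_{i(e)}}$ and $p_e|_{K_{i(e)}}$ are uniformly continuous for each $e\in E$. $\mathcal{M}$ has a dominating Markov chain iff $\sum_{e\in E,\,i(e)=i}\sup_{x\in K_i}p_e(x)<\infty$ for every $i\in N$. Code space: $\bar E:=E\cup\{\infty\}$ is the one-point compactification of discrete $E$; $w_\infty:=\mathrm{id}$, $p_\infty:=0$, $i(\infty)=t(\infty):=1$. $\bar\Sigma:=\bar E^{\mathbb{Z}}$ with the product topology; $(S\sigma)_{i-1}=\sigma_i$; $P_S(\bar\Sigma)$ is the set of $S$-invariant Borel probability measures. ${}_m[e_m,\dots,e_n]:=\{\sigma\in\bar\Sigma:\sigma_i=e_i,\ m\le i\le n\}$. $\mathcal{F}$ is the $\sigma$-algebra generated by all cylinders ${}_m[e_m,\dots,e_0]$, $m\le0$. $\Sigma_G:=\{\sigma\in\bar\Sigma:\sigma_n\in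 E,\ i(\sigma_{n+1})=t(\sigma_n)\ \forall n\in\mathbb{Z}\}$. Fix $x_i\in K_i$ for each $i\in N$. $D:=\{\sigma\in\Sigma_G:\lim_{m\to-\infty}w_{\sigma_0}\circ\dots\circ w_{\sigma_m}(x_{i(\sigma_m)})\text{ exists}\}$; $F:\bar\Sigma\to K$ is this limit on $D$, and $F(\sigma):=x_{t(\sigma_0)}$ for $\sigma\notin D$. $F(\Lambda):=\Lambda\circ F^{-1}$. $T_j:=\{\sigma\in\Sigma_G:t(\sigma_0)=j\}$. $\bar p_e$ is the continuous extension of $p_e|_{K_{i(e)}}$ to $\bar K_{i(e)}$, extended by zero to $K$. $\tilde E(\mathcal{M})$ is the set of $\Lambda\in P_S(\bar\Sigma)$ with $\Lambda(D)=1$ and $E_\Lambda(1_{{}_1[e]}|\mathcal{F})=(\bar p_e\circ F)\,1_{T_{i(e)}}$ $\Lambda$-a.e. for all $e\in E$. A uniformly continuous $\mathcal{M}$ is consistent iff $F(M)\in P(\mathcal{M})$ for all $M\in\tilde E(\mathcal{M})$. *)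

theory Defs
  imports "HOL-Probability.Probability"
begin

record ('i, 'k) rds =
  rds_index :: "'i set"
  rds_map   :: "'i \<Rightarrow> 'k \<Rightarrow> 'k"
  rds_prob  :: "'i \<Rightarrow> 'k \<Rightarrow> real"

definition random_dynamical_system :: "('i, 'k::metric_space) rds \<Rightarrow> bool" where
  "random_dynamical_system R \<longleftrightarrow>
     countable (rds_index R) \<and>
     (\<forall>e\<in>rds_index R.
        rds_map R e \<in> borel_measurable borel \<and>
        rds_prob R e \<in> borel_measurable borel \<and>
        (\<forall>x. 0 \<le> rds_prob R e x \<and> rds_prob R e x \<le> 1)) \<and>
     (\<forall>x. ((\<lambda>e. rds_prob R e x) has_sum 1) (rds_index R))"

definition continuous_rds :: "('i, 'k::metric_space) rds \<Rightarrow> bool" where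
  "continuous_rds R \<longleftrightarrow>
     (\<forall>e\<in>rds_index R. continuous_on UNIV (rds_map R e) \<and> continuous_on UNIV (rds_prob R e))"

definition borel_partition :: "nat set \<Rightarrow> (nat \<Rightarrow> 'k::topological_space set) \<Rightarrow> bool" where
  "borel_partition N K \<longleftrightarrow>
     (\<forall>j\<in>N. K j \<noteq> {} \<and> K j \<in> sets borel) \<and>
     disjoint_family_on K N \<and> (\<Union>j\<in>N. K j) = UNIV"

record ('e, 'k) markov_system =
  vertices :: "nat set"
  atom     :: "nat \<Rightarrow> 'k set"
  edges    :: "'e set"
  ini      :: "'e \<Rightarrow> nat"
  ter      :: "'e \<Rightarrow> nat"
  wmap     :: "'e \<Rightarrow> 'k \<Rightarrow> 'k"
  eprob    :: "'e \<Rightarrow> 'k \<Rightarrow> real"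

text \<open>The maps and probability functions are those already extended to the whole space:
  \<open>eprob M e\<close> by zero outside \<open>atom M (ini M e)\<close>, and \<open>wmap M e\<close> by an arbitrary Borel map.\<close>

definition countable_markov_system :: "('e, 'k::metric_space) markov_system \<Rightarrow> bool" where
  "countable_markov_system M \<longleftrightarrow>
     1 \<in> vertices M \<and>
     borel_partition (vertices M) (atom M) \<and>
     countable (edges M) \<and>
     ini M ` edges M = vertices M \<and>
     ter M ` edges M \<subseteq> vertices M \<and>
     (\<forall>e\<in>edges M.
        wmap M e \<in> borel_measurable borel \<and>
        wmap M e ` atom M (ini M e) \<subseteq> atom M (ter M e) \<and>
        eprob M e \<in> borel_measurable borel \<and>
        (\<forall>x\<in>atom M (ini M e). 0 \<le> eprob M e x \<and> eprob M e x \<le> 1) \<and>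
        (\<exists>x\<in>atom M (ini M e). eprob M e x \<noteq> 0) \<and>
        (\<forall>x. x \<notin> atom M (ini M e) \<longrightarrow> eprob M e x = 0)) \<and>
     (\<forall>j\<in>vertices M. \<forall>x\<in>atom M j.
        ((\<lambda>e. eprob M e x) has_sum 1) {e \<in> edges M. ini M e = j})"

text \<open>The bijection \<open>\<phi>\<close> is the re-indexing of the edges by pairs.\<close>

definition resulting_markov_system ::
  "('i, 'k::metric_space) rds \<Rightarrow> nat set \<Rightarrow> (nat \<Rightarrow> 'k set) \<Rightarrow> ('e, 'k) markov_system \<Rightarrow> bool" where
  "resulting_markov_system R N K M \<longleftrightarrow>
     countable_markov_system M \<and>
     vertices M = N \<and> (\<forall>j\<in>N. atom M j = K j) \<and>
     (\<exists>\<phi>. bij_betw \<phi> (edges M)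
              {(e', j). e' \<in> rds_index R \<and> j \<in> N \<and> (\<exists>x\<in>K j. rds_prob R e' x \<noteq> 0)} \<and>
          (\<forall>e\<in>edges M. \<forall>e' j. \<phi> e = (e', j) \<longrightarrow>
              ini M e = j \<and>
              (\<forall>x\<in>K j. wmap M e x = rds_map R e' x) \<and>
              (\<forall>x\<in>K j. eprob M e x = rds_prob R e' x) \<and>
              rds_map R e' ` K j \<subseteq> K (ter M e)))"

definition markov_partition ::
  "('i, 'k::metric_space) rds \<Rightarrow> nat set \<Rightarrow> (nat \<Rightarrow> 'k set) \<Rightarrow> bool" where
  "markov_partition R N K \<longleftrightarrow>
     borel_partition N K \<and>
     (\<exists>M :: ('i \<times> nat, 'k) markov_system. resulting_markov_system R N K M)"

definition uniformly_continuous_ms :: "('e, 'k::metric_space) markov_system \<Rightarrow> bool" where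
  "uniformly_continuous_ms M \<longleftrightarrow>
     (\<forall>e\<in>edges M. uniformly_continuous_on (atom M (ini M e)) (wmap M e) \<and>
                  uniformly_continuous_on (atom M (ini M e)) (eprob M e))"

text \<open>All terms of the series lie in \<open>[0, 1]\<close>, so summability says that the sum is finite.\<close>

definition has_dominating_markov_chain :: "('e, 'k::metric_space) markov_system \<Rightarrow> bool" where
  "has_dominating_markov_chain M \<longleftrightarrow>
     (\<forall>j\<in>vertices M.
        (\<lambda>e. SUP x\<in>atom M j. eprob M e x) summable_on {e \<in> edges M. ini M e = j})"

text \<open>\<open>f\<close> is meant to be nonnegative; the value of \<open>markov_op M f\<close> may then be infinite.\<close>

definition markov_op :: "('e, 'k) markov_system \<Rightarrow> ('k \<Rightarrow> real) \<Rightarrow> 'k \<Rightarrow> ennreal" where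
  "markov_op M f x = (\<Sum>\<^sub>\<infinity>e\<in>edges M. ennreal (eprob M e x * f (wmap M e x)))"

definition markov_adj :: "('e, 'k) markov_system \<Rightarrow> 'k measure \<Rightarrow> ('k \<Rightarrow> real) \<Rightarrow> ennreal" where
  "markov_adj M \<nu> f = (\<integral>\<^sup>+ x. markov_op M f x \<partial>\<nu>)"

definition invariant_measures :: "('e, 'k::metric_space) markov_system \<Rightarrow> 'k measure set" where
  "invariant_measures M =
     {\<mu>. prob_space \<mu> \<and> sets \<mu> = sets borel \<and>
          (\<forall>f\<in>borel_measurable borel. (\<forall>x. 0 \<le> f x) \<and> bounded (range f) \<longrightarrow>
              markov_adj M \<mu> f = (\<integral>\<^sup>+ x. ennreal (f x) \<partial>\<mu>))}"

definition borel_of_topology :: "'a topology \<Rightarrow> 'a measure" where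
  "borel_of_topology X = sigma (topspace X) {U. openin X U}"

text \<open>In the one-point compactification of the discrete space \<open>edges M\<close>, a letter \<open>e\<close> is
  \<open>Some e\<close> and the point at infinity is \<open>None\<close>.\<close>

definition code_top :: "('e, 'k) markov_system \<Rightarrow> (int \<Rightarrow> 'e option) topology" where
  "code_top M =
     product_topology (\<lambda>_. Alexandroff_compactification (discrete_topology (edges M))) UNIV"

abbreviation code_space :: "('e, 'k) markov_system \<Rightarrow> (int \<Rightarrow> 'e option) set" where
  "code_space M \<equiv> topspace (code_top M)"

definition wmap_ext :: "('e, 'k) markov_system \<Rightarrow> 'e option \<Rightarrow> 'k \<Rightarrow> 'k" where
  "wmap_ext M a = (case a of None \<Rightarrow> id | Some e \<Rightarrow> wmap M e)"

definition ini_ext :: "('e, 'k) markov_system \<Rightarrow> 'e option \<Rightarrow> nat" where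
  "ini_ext M a = (case a of None \<Rightarrow> 1 | Some e \<Rightarrow> ini M e)"

definition ter_ext :: "('e, 'k) markov_system \<Rightarrow> 'e option \<Rightarrow> nat" where
  "ter_ext M a = (case a of None \<Rightarrow> 1 | Some e \<Rightarrow> ter M e)"

definition shift :: "(int \<Rightarrow> 'b) \<Rightarrow> int \<Rightarrow> 'b" where
  "shift \<sigma> = (\<lambda>i. \<sigma> (i + 1))"

definition shift_invariant_measures ::
  "('e, 'k) markov_system \<Rightarrow> (int \<Rightarrow> 'e option) measure set" where
  "shift_invariant_measures M =
     {\<Lambda>. prob_space \<Lambda> \<and> sets \<Lambda> = sets (borel_of_topology (code_top M)) \<and>
          distr \<Lambda> \<Lambda> shift = \<Lambda>}"

text \<open>Only the values of \<open>a\<close> on \<open>{m..n}\<close> matter.\<close>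

definition cylinder ::
  "('e, 'k) markov_system \<Rightarrow> int \<Rightarrow> int \<Rightarrow> (int \<Rightarrow> 'e option) \<Rightarrow> (int \<Rightarrow> 'e option) set" where
  "cylinder M m n a = {\<sigma> \<in> code_space M. \<forall>i\<in>{m..n}. \<sigma> i = a i}"

definition past_algebra :: "('e, 'k) markov_system \<Rightarrow> (int \<Rightarrow> 'e option) measure" where
  "past_algebra M =
     sigma (code_space M) {cylinder M m 0 a | m a. m \<le> 0 \<and> a \<in> code_space M}"

definition path_space :: "('e, 'k) markov_system \<Rightarrow> (int \<Rightarrow> 'e option) set" where
  "path_space M =
     {\<sigma> \<in> code_space M. \<forall>n. \<sigma> n \<in> Some ` edges M \<and> ini_ext M (\<sigma> (n + 1)) = ter_ext M (\<sigma> n)}"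

text \<open>\<open>past_comp M \<sigma> n\<close> is the composition of the maps of the letters at the positions
  \<open>0, -1, \<dots>, -n\<close>, the one at \<open>-n\<close> being applied first.\<close>

primrec past_comp :: "('e, 'k) markov_system \<Rightarrow> (int \<Rightarrow> 'e option) \<Rightarrow> nat \<Rightarrow> 'k \<Rightarrow> 'k" where
  "past_comp M \<sigma> 0 = wmap_ext M (\<sigma> 0)"
| "past_comp M \<sigma> (Suc n) = past_comp M \<sigma> n \<circ> wmap_ext M (\<sigma> (- int (Suc n)))"

definition coding_seq ::
  "('e, 'k) markov_system \<Rightarrow> (nat \<Rightarrow> 'k) \<Rightarrow> (int \<Rightarrow> 'e option) \<Rightarrow> nat \<Rightarrow> 'k" where
  "coding_seq M x \<sigma> n = past_comp M \<sigma> n (x (ini_ext M (\<sigma> (- int n))))"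

definition coding_domain ::
  "('e, 'k::metric_space) markov_system \<Rightarrow> (nat \<Rightarrow> 'k) \<Rightarrow> (int \<Rightarrow> 'e option) set" where
  "coding_domain M x = {\<sigma> \<in> path_space M. convergent (coding_seq M x \<sigma>)}"

definition coding_map ::
  "('e, 'k::metric_space) markov_system \<Rightarrow> (nat \<Rightarrow> 'k) \<Rightarrow> (int \<Rightarrow> 'e option) \<Rightarrow> 'k" where
  "coding_map M x \<sigma> =
     (if \<sigma> \<in> coding_domain M x then lim (coding_seq M x \<sigma>) else x (ter_ext M (\<sigma> 0)))"

definition ending_in :: "('e, 'k) markov_system \<Rightarrow> nat \<Rightarrow> (int \<Rightarrow> 'e option) set" where
  "ending_in M j = {\<sigma> \<in> path_space M. ter_ext M (\<sigma> 0) = j}"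

text \<open>The extension exists and is unique if \<open>eprob M e\<close> is uniformly continuous on its atom.\<close>

definition eprob_bar :: "('e, 'k::metric_space) markov_system \<Rightarrow> 'e \<Rightarrow> 'k \<Rightarrow> real" where
  "eprob_bar M e =
     (THE g. continuous_on (closure (atom M (ini M e))) g \<and>
             (\<forall>x\<in>atom M (ini M e). g x = eprob M e x) \<and>
             (\<forall>x. x \<notin> closure (atom M (ini M e)) \<longrightarrow> g x = 0))"

definition tilde_E ::
  "('e, 'k::metric_space) markov_system \<Rightarrow> (nat \<Rightarrow> 'k) \<Rightarrow> (int \<Rightarrow> 'e option) measure set" where
  "tilde_E M x =
     {\<Lambda> \<in> shift_invariant_measures M.
        measure \<Lambda> (coding_domain M x) = 1 \<and>
        (\<forall>e\<in>edges M. AE \<sigma> in \<Lambda>.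
           real_cond_exp \<Lambda> (past_algebra M) (indicator (cylinder M 1 1 (\<lambda>_. Some e))) \<sigma> =
           eprob_bar M e (coding_map M x \<sigma>) * indicator (ending_in M (ini M e)) \<sigma>)}"

text \<open>The notion is meant for uniformly continuous Markov systems.\<close>

definition consistent :: "('e, 'k::metric_space) markov_system \<Rightarrow> (nat \<Rightarrow> 'k) \<Rightarrow> bool" where
  "consistent M x \<longleftrightarrow>
     (\<forall>\<Lambda>\<in>tilde_E M x. distr \<Lambda> borel (coding_map M x) \<in> invariant_measures M)"

end

theory Submission
  imports Defs
begin

text \<open>
  Let \<open>\<Lambda>\<close> be a shift-invariant measure in \<open>tilde_E M x\<close> and let \<open>F\<close> be the coding map. The image of
  \<open>\<Lambda>\<close> under \<open>F\<close> is invariant because the shift transports one step of the Markov system.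

  If \<open>\<sigma>\<close> is in the domain of \<open>F\<close> and its letter at position 1 is \<open>e\<close>, then the points whose limit is
  \<open>F (shift \<sigma>)\<close> are the images under \<open>wmap M e\<close> of the points whose limit is \<open>F \<sigma>\<close>. The limit \<open>F \<sigma>\<close>
  may leave the atom that contains these points and only lies in its closure, but the map
  \<open>w e\<close> of the random dynamical system behind \<open>e\<close> is continuous on the whole space, so that
  \<open>F (shift \<sigma>) = w e (F \<sigma>)\<close> (lemma \<open>coding_map_shift\<close>). Hence, for a bounded Borel function
  \<open>f \<ge> 0\<close>, shift invariance gives
  \[
    \int f \circ F \, d\Lambda = \int f \circ F \circ \mathrm{shift} \, d\Lambda
      = \sum_e \int_{\sigma_1 = e} f (w_e (F \sigma)) \, d\Lambda .
  \]
  The function \<open>F\<close> is almost surely a function of the past, and the conditional probability of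
  \<open>\<sigma> 1 = e\<close> given the past is prescribed by membership in \<open>tilde_E M x\<close>. On the closure of the
  initial atom of \<open>e\<close> the extension \<open>eprob_bar M e\<close> coincides with the continuous global
  probability function \<open>p e\<close> of the random dynamical system, whence (lemma \<open>nn_integral_edge\<close>)
  \[
    \int f \circ F \, d\Lambda
      = \int \sum_{i(e) = t(\sigma_0)} p_e (F \sigma) \, f (w_e (F \sigma)) \, d\Lambda .
  \]

  It remains to see that the integrand is \<open>markov_op M f (F \<sigma>)\<close>. The operator at a point \<open>y\<close>
  sums over the edges that start in the atom containing \<open>y\<close>, whereas here the sum is over the edges
  that start in an atom whose closure contains \<open>y\<close>. Both sums equal the sum of
  \<open>rds_prob R e' y * f (rds_map R e' y)\<close> over all indices \<open>e'\<close>: an index that gives no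
  edge at an atom has probability zero on that atom, hence, by continuity, on its closure (lemma
  \<open>resulting_sum_on_closure\<close>). This agreement of local sums, which fails for general Markov systems,
  is the assumption \<open>glue\<close> of the locale \<open>continuously_extended\<close>.
\<close>

section \<open>Sums of extended nonnegative numbers\<close>

lemma nn_integral_count_space_eq_infsum:
  fixes f :: "'b \<Rightarrow> ennreal"
  assumes "countable A"
  shows "(\<integral>\<^sup>+ a. f a \<partial>count_space A) = (\<Sum>\<^sub>\<infinity>a\<in>A. f a)"
proof (cases "finite A")
  case True
  then show ?thesis by (simp add: nn_integral_count_space_finite)
next
  case False
  have bij: "bij_betw (from_nat_into A) UNIV A"
    using assms False by (rule bij_betw_from_nat_into)
  have "(\<lambda>n. f (from_nat_into A n)) summable_on UNIV"
    by (rule nonneg_summable_on_complete) simp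
  then have "(\<lambda>n. f (from_nat_into A n)) sums (\<Sum>\<^sub>\<infinity>n. f (from_nat_into A n))"
    by (intro has_sum_imp_sums has_sum_infsum)
  then have "(\<Sum>n. f (from_nat_into A n)) = (\<Sum>\<^sub>\<infinity>n. f (from_nat_into A n))"
    by (simp add: sums_iff)
  then show ?thesis
    using nn_integral_bij_count_space[OF bij, of f] infsum_reindex_bij_betw[OF bij, of f]
    by (simp add: nn_integral_count_space_nat)
qed

section \<open>Measurability on the code space\<close>

lemma in_code_space_iff:
  "\<sigma> \<in> code_space M \<longleftrightarrow> (\<forall>i. \<sigma> i \<in> insert None (Some ` edges M))"
  by (auto simp: code_top_def PiE_iff)

lemma space_borel_of_code_top [simp]: "space (borel_of_topology (code_top M)) = code_space M"
  by (simp add: borel_of_topology_def space_measure_of_conv)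

lemma openin_imp_borel:
  assumes "openin X U"
  shows "U \<in> sets (borel_of_topology X)"
proof -
  have "{U. openin X U} \<subseteq> Pow (topspace X)"
    using openin_subset by auto
  then show ?thesis
    using assms by (simp add: borel_of_topology_def)
qed

text \<open>Measurability is what makes the equation \<open>distr \<Lambda> \<Lambda> shift = \<Lambda>\<close> usable for a change of variables.\<close>

lemma shift_measurable:
  "shift \<in> measurable (borel_of_topology (code_top M)) (borel_of_topology (code_top M))"
proof -
  have cont: "continuous_map (code_top M) (code_top M) shift"
    unfolding code_top_def shift_def
    by (auto simp: continuous_map_componentwise_UNIV intro: continuous_map_product_projection)
  have sub: "{U. openin (code_top M) U} \<subseteq> Pow (code_space M)"
    using openin_subset by auto
  show ?thesis
  proof (subst (2) borel_of_topology_def, rule measurable_measure_of[OF sub])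
    show "shift \<in> space (borel_of_topology (code_top M)) \<rightarrow> code_space M"
      using cont by (auto simp: continuous_map_def)
    show "shift -` U \<inter> space (borel_of_topology (code_top M)) \<in> sets (borel_of_topology (code_top M))"
      if "U \<in> {U. openin (code_top M) U}" for U
    proof -
      have "openin (code_top M) {\<sigma> \<in> code_space M. shift \<sigma> \<in> U}"
        using cont that by (auto simp: continuous_map_def)
      moreover have "shift -` U \<inter> code_space M = {\<sigma> \<in> code_space M. shift \<sigma> \<in> U}"
        by auto
      ultimately show ?thesis
        by (simp add: openin_imp_borel)
    qed
  qed
qed

text \<open>A set of edges is open in the compactification, so that the coordinate condition for an edge is
  open; the condition for the point at infinity is the complement of the one for all edges.\<close>

lemma coordinate_borel:
  assumes "a \<in> insert None (Some ` edges M)"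
  shows "{\<sigma> \<in> code_space M. \<sigma> i = a} \<in> sets (borel_of_topology (code_top M))"
proof -
  have pre: "{\<sigma> \<in> code_space M. \<sigma> i \<in> Some ` B} \<in> sets (borel_of_topology (code_top M))"
    if "B \<subseteq> edges M" for B
  proof (rule openin_imp_borel)
    have "continuous_map (code_top M) (Alexandroff_compactification (discrete_topology (edges M))) (\<lambda>\<sigma>. \<sigma> i)"
      unfolding code_top_def by (intro continuous_map_product_projection) auto
    moreover have "openin (Alexandroff_compactification (discrete_topology (edges M))) (Some ` B)"
      using that by simp
    ultimately show "openin (code_top M) {\<sigma> \<in> code_space M. \<sigma> i \<in> Some ` B}"
      by (auto simp: continuous_map_def)
  qed
  show ?thesis
  proof (cases a)
    case (Some e)
    then show ?thesis using pre[of "{e}"] assms by auto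
  next
    case None
    have "{\<sigma> \<in> code_space M. \<sigma> i = None} =
        space (borel_of_topology (code_top M)) - {\<sigma> \<in> code_space M. \<sigma> i \<in> Some ` edges M}"
      using in_code_space_iff[of _ M] by fastforce
    then show ?thesis
      using sets.compl_sets[OF pre[of "edges M"]] None by simp
  qed
qed

lemma cylinder_borel:
  assumes "\<And>i. m \<le> i \<Longrightarrow> i \<le> n \<Longrightarrow> a i \<in> insert None (Some ` edges M)"
  shows "cylinder M m n a \<in> sets (borel_of_topology (code_top M))"
proof -
  have "cylinder M m n a =
      {\<sigma> \<in> space (borel_of_topology (code_top M)). \<forall>i\<in>{m..n}. \<sigma> i = a i}"
    by (simp add: cylinder_def)
  also have "\<dots> \<in> sets (borel_of_topology (code_top M))"
    using assms
    by (intro sets.sets_Collect_finite_All) (auto intro!: coordinate_borel)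
  finally show ?thesis .
qed

lemma past_algebra_space [simp]: "space (past_algebra M) = code_space M"
  by (simp add: past_algebra_def space_measure_of_conv)

lemma past_cylinder:
  assumes "m \<le> 0" "a \<in> code_space M"
  shows "cylinder M m 0 a \<in> sets (past_algebra M)"
proof -
  have "{cylinder M m 0 a | m a. m \<le> 0 \<and> a \<in> code_space M} \<subseteq> Pow (code_space M)"
    by (auto simp: cylinder_def)
  then show ?thesis
    using assms by (auto simp: past_algebra_def)
qed

lemma past_algebra_subset_borel:
  "sets (past_algebra M) \<subseteq> sets (borel_of_topology (code_top M))"
proof -
  have sub: "{cylinder M m 0 a | m a. m \<le> 0 \<and> a \<in> code_space M} \<subseteq> Pow (code_space M)"
    by (auto simp: cylinder_def)
  show ?thesis
    unfolding past_algebra_def sets_measure_of[OF sub]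
    using sets.sigma_sets_subset[of "{cylinder M m 0 a | m a. m \<le> 0 \<and> a \<in> code_space M}"
        "borel_of_topology (code_top M)"]
    by (auto intro!: cylinder_borel simp: in_code_space_iff)
qed

text \<open>As there are countably many letters, there are countably many cylinders over a finite window,
  and a set that only depends on the window is the union of those it contains. So every
  function of finitely many past letters is measurable, whatever its target space.\<close>

lemma past_set:
  assumes E: "countable (edges M)" and m: "m \<le> 0" and B: "B \<subseteq> code_space M"
    and dep: "\<And>\<sigma> \<tau>. \<sigma> \<in> B \<Longrightarrow> \<tau> \<in> code_space M \<Longrightarrow> (\<And>i. m \<le> i \<Longrightarrow> i \<le> 0 \<Longrightarrow> \<tau> i = \<sigma> i) \<Longrightarrow> \<tau> \<in> B"
  shows "B \<in> sets (past_algebra M)"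
proof -
  have "countable (PiE {m..0} (\<lambda>_. insert None (Some ` edges M)))"
    using E by (intro countable_PiE) auto
  moreover have "cylinder M m 0 ` B \<subseteq>
      cylinder M m 0 ` PiE {m..0} (\<lambda>_. insert None (Some ` edges M))"
  proof (rule image_subsetI)
    fix a assume "a \<in> B"
    then have "restrict a {m..0} \<in> PiE {m..0} (\<lambda>_. insert None (Some ` edges M))"
      using B by (auto simp: in_code_space_iff subset_iff)
    moreover have "cylinder M m 0 a = cylinder M m 0 (restrict a {m..0})"
      by (auto simp: cylinder_def)
    ultimately show "cylinder M m 0 a \<in> cylinder M m 0 ` PiE {m..0} (\<lambda>_. insert None (Some ` edges M))"
      by blast
  qed
  ultimately have "countable (cylinder M m 0 ` B)"
    by (meson countable_image countable_subset)
  then have "\<Union> (cylinder M m 0 ` B) \<in> sets (past_algebra M)"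
    using past_cylinder[OF m] B by (intro sets.countable_Union) auto
  moreover have "\<Union> (cylinder M m 0 ` B) = B"
    using B dep by (fastforce simp: cylinder_def)
  ultimately show ?thesis by simp
qed

lemma past_measurable:
  assumes "countable (edges M)" "m \<le> 0"
    and "\<And>\<sigma>. \<sigma> \<in> code_space M \<Longrightarrow> h \<sigma> \<in> space L"
    and dep: "\<And>\<sigma> \<tau>. (\<And>i. m \<le> i \<Longrightarrow> i \<le> 0 \<Longrightarrow> \<tau> i = \<sigma> i) \<Longrightarrow> h \<tau> = h \<sigma>"
  shows "h \<in> measurable (past_algebra M) L"
proof (rule measurableI)
  show "h -` A \<inter> space (past_algebra M) \<in> sets (past_algebra M)" for A
  proof (rule past_set[OF assms(1,2)])
    fix \<sigma> \<tau>
    assume *: "\<sigma> \<in> h -` A \<inter> space (past_algebra M)" "\<tau> \<in> code_space M"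
      and eq: "\<And>i. m \<le> i \<Longrightarrow> i \<le> 0 \<Longrightarrow> \<tau> i = \<sigma> i"
    have "h \<tau> = h \<sigma>"
      using eq by (rule dep)
    then show "\<tau> \<in> h -` A \<inter> space (past_algebra M)"
      using * by simp
  qed auto
qed (use assms(3) in simp)

section \<open>The coding map\<close>

lemma past_comp_cong:
  assumes "\<And>i. - int n \<le> i \<Longrightarrow> i \<le> 0 \<Longrightarrow> \<tau> i = \<sigma> i"
  shows "past_comp M \<tau> n = past_comp M \<sigma> n"
  using assms by (induction n) auto

lemma coding_seq_cong:
  assumes "\<And>i. - int n \<le> i \<Longrightarrow> i \<le> 0 \<Longrightarrow> \<tau> i = \<sigma> i"
  shows "coding_seq M x \<tau> n = coding_seq M x \<sigma> n"
  using past_comp_cong[of n \<tau> \<sigma> M, OF assms] assms[of "- int n"] by (simp add: coding_seq_def)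

text \<open>The domain of the coding map restricts the letters at positive positions too, so that the coding
  map itself is not measurable with respect to the past. This version of it is, and the two agree
  on the domain. The value \<open>x 1\<close> is an arbitrary constant.\<close>

definition past_limit ::
  "('e, 'k::metric_space) markov_system \<Rightarrow> (nat \<Rightarrow> 'k) \<Rightarrow> (int \<Rightarrow> 'e option) \<Rightarrow> 'k" where
  "past_limit M x \<sigma> = (if convergent (coding_seq M x \<sigma>) then lim (coding_seq M x \<sigma>) else x 1)"

text \<open>Convergence is the Cauchy condition. The distances in it are functions of finitely many
  letters, hence measurable although on a non-separable space the distance of two
  Borel functions need not be.\<close>

lemma past_limit_measurable:
  fixes M :: "('e, 'k::complete_space) markov_system"
  assumes E: "countable (edges M)"
  shows "past_limit M x \<in> borel_measurable (past_algebra M)"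
proof -
  have seq [measurable]: "(\<lambda>\<sigma>. coding_seq M x \<sigma> n) \<in> borel_measurable (past_algebra M)" for n
    by (rule past_measurable[OF E, of "- int n"]) (auto intro: coding_seq_cong)
  have dist [measurable]:
    "(\<lambda>\<sigma>. dist (coding_seq M x \<sigma> m) (coding_seq M x \<sigma> n)) \<in> borel_measurable (past_algebra M)" for m n
    by (rule past_measurable[OF E, of "- int (max m n)"])
      (auto intro!: arg_cong2[of _ _ _ _ dist] coding_seq_cong)
  have [measurable]: "Measurable.pred (past_algebra M) (\<lambda>\<sigma>. convergent (coding_seq M x \<sigma>))"
    unfolding Cauchy_convergent_iff[symmetric] metric_Cauchy_iff2 by measurable
  show ?thesis
  proof (rule borel_measurable_LIMSEQ_metric)
    show "(\<lambda>\<sigma>. if convergent (coding_seq M x \<sigma>) then coding_seq M x \<sigma> n else x 1)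
        \<in> borel_measurable (past_algebra M)" for n
      by measurable
    show "(\<lambda>n. if convergent (coding_seq M x \<sigma>) then coding_seq M x \<sigma> n else x 1)
        \<longlonglongrightarrow> past_limit M x \<sigma>" for \<sigma>
      by (simp add: past_limit_def convergent_LIMSEQ_iff)
  qed
qed

lemma coding_map_eq_past_limit:
  "\<sigma> \<in> coding_domain M x \<Longrightarrow> coding_map M x \<sigma> = past_limit M x \<sigma>"
  by (simp add: coding_map_def past_limit_def coding_domain_def)

lemma coding_seq_tendsto:
  "\<sigma> \<in> coding_domain M x \<Longrightarrow> coding_seq M x \<sigma> \<longlonglongrightarrow> coding_map M x \<sigma>"
  by (simp add: coding_map_def coding_domain_def convergent_LIMSEQ_iff)

text \<open>The shift leaves the oldest letter of the composition in place and adds \<open>\<sigma> 1\<close> as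
  the map that is applied last.\<close>

lemma past_comp_shift:
  "past_comp M (shift \<sigma>) (Suc n) y = wmap_ext M (\<sigma> 1) (past_comp M \<sigma> n y)"
  by (induction n arbitrary: y) (simp_all add: shift_def)

lemma coding_seq_shift:
  "coding_seq M x (shift \<sigma>) (Suc n) = wmap_ext M (\<sigma> 1) (coding_seq M x \<sigma> n)"
  unfolding coding_seq_def past_comp_shift by (simp add: shift_def)

lemma shift_path_space: "\<sigma> \<in> path_space M \<Longrightarrow> shift \<sigma> \<in> path_space M"
proof -
  assume "\<sigma> \<in> path_space M"
  then have *: "\<sigma> i \<in> insert None (Some ` edges M)" "\<sigma> i \<in> Some ` edges M"
    "ini_ext M (\<sigma> (i + 1)) = ter_ext M (\<sigma> i)" for i
    unfolding path_space_def in_code_space_iff by blast+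
  show ?thesis
    unfolding path_space_def in_code_space_iff shift_def using * by (intro CollectI conjI allI)
qed

lemma past_comp_in_atom:
  assumes M: "countable_markov_system M" and \<sigma>: "\<sigma> \<in> path_space M"
    and y: "y \<in> atom M (ini_ext M (\<sigma> (- int n)))"
  shows "past_comp M \<sigma> n y \<in> atom M (ter_ext M (\<sigma> 0))"
proof -
  have step: "wmap_ext M (\<sigma> i) z \<in> atom M (ter_ext M (\<sigma> i))"
    if "z \<in> atom M (ini_ext M (\<sigma> i))" for i z
  proof -
    obtain e where "e \<in> edges M" "\<sigma> i = Some e"
      using \<sigma> by (auto simp: path_space_def)
    moreover from this have "wmap M e ` atom M (ini M e) \<subseteq> atom M (ter M e)"
      using M by (simp add: countable_markov_system_def)
    ultimately show ?thesis
      using that by (auto simp: wmap_ext_def ini_ext_def ter_ext_def)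
  qed
  show ?thesis
    using y
  proof (induction n arbitrary: y)
    case 0
    then show ?case using step[of y 0] by simp
  next
    case (Suc n)
    have "ini_ext M (\<sigma> (- int (Suc n) + 1)) = ter_ext M (\<sigma> (- int (Suc n)))"
      using \<sigma> unfolding path_space_def by blast
    then have "ter_ext M (\<sigma> (- int (Suc n))) = ini_ext M (\<sigma> (- int n))"
      by simp
    with step[OF Suc.prems] show ?case
      using Suc.IH[of "wmap_ext M (\<sigma> (- int (Suc n))) y"] by simp
  qed
qed

section \<open>Systems whose maps and probabilities extend continuously\<close>

text \<open>The functions \<open>w e\<close> and \<open>p e\<close> extend the map and the probability function of an edge
  continuously from its initial atom to the whole space. The assumption \<open>glue\<close> says that on the
  common boundary of atoms the averages over the outgoing edges of the atoms agree; then the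
  Markov operator can be evaluated with the edges of any atom whose closure contains the point.\<close>

locale continuously_extended =
  fixes M :: "('e, 'k::complete_space) markov_system"
    and x :: "nat \<Rightarrow> 'k"
    and w :: "'e \<Rightarrow> 'k \<Rightarrow> 'k"
    and p :: "'e \<Rightarrow> 'k \<Rightarrow> real"
  assumes M: "countable_markov_system M"
    and base: "j \<in> vertices M \<Longrightarrow> x j \<in> atom M j"
    and w_cont: "e \<in> edges M \<Longrightarrow> continuous_on UNIV (w e)"
    and p_cont: "e \<in> edges M \<Longrightarrow> continuous_on UNIV (p e)"
    and w_eq: "e \<in> edges M \<Longrightarrow> y \<in> atom M (ini M e) \<Longrightarrow> w e y = wmap M e y"
    and p_eq: "e \<in> edges M \<Longrightarrow> y \<in> atom M (ini M e) \<Longrightarrow> p e y = eprob M e y"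
    and glue: "\<lbrakk>i \<in> vertices M; j \<in> vertices M; y \<in> atom M i; y \<in> closure (atom M j); \<And>z. 0 \<le> f z\<rbrakk> \<Longrightarrow>
      (\<integral>\<^sup>+ e. ennreal (p e y * f (w e y)) \<partial>count_space {e \<in> edges M. ini M e = i}) =
      (\<integral>\<^sup>+ e. ennreal (p e y * f (w e y)) \<partial>count_space {e \<in> edges M. ini M e = j})"
begin

lemma countable_edges: "countable (edges M)"
  using M by (simp add: countable_markov_system_def)

text \<open>A continuous extension to the closure is determined by its values on the atom, and
  \<open>p e\<close> provides one.\<close>

lemma eprob_bar_eq:
  assumes e: "e \<in> edges M"
  shows "eprob_bar M e = (\<lambda>y. if y \<in> closure (atom M (ini M e)) then p e y else 0)"
    (is "_ = ?g")
  unfolding eprob_bar_def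
proof (rule the_equality)
  let ?A = "atom M (ini M e)"
  have p': "continuous_on (closure ?A) (p e)"
    using p_cont[OF e] continuous_on_subset by blast
  have "continuous_on (closure ?A) ?g"
    using p' by (rule continuous_on_eq) auto
  then show "continuous_on (closure ?A) ?g \<and> (\<forall>y\<in>?A. ?g y = eprob M e y) \<and>
      (\<forall>y. y \<notin> closure ?A \<longrightarrow> ?g y = 0)"
    using p_eq[OF e] closure_subset[of ?A] by auto
  fix g assume g: "continuous_on (closure ?A) g \<and> (\<forall>y\<in>?A. g y = eprob M e y) \<and>
      (\<forall>y. y \<notin> closure ?A \<longrightarrow> g y = 0)"
  have "g y - p e y = 0" if "y \<in> closure ?A" for y
    using g p' p_eq[OF e] that
    by (intro continuous_constant_on_closure[of ?A "\<lambda>y. g y - p e y" 0 y])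
      (auto intro: continuous_on_diff)
  then show "g = ?g"
    using g by auto
qed

lemma coding_seq_in_atom:
  assumes "\<sigma> \<in> path_space M"
  shows "coding_seq M x \<sigma> n \<in> atom M (ter_ext M (\<sigma> 0))"
proof -
  obtain e where "e \<in> edges M" "\<sigma> (- int n) = Some e"
    using assms by (auto simp: path_space_def)
  then have "ini_ext M (\<sigma> (- int n)) \<in> vertices M"
    using M by (auto simp: ini_ext_def countable_markov_system_def)
  then show ?thesis
    unfolding coding_seq_def by (intro past_comp_in_atom[OF M assms] base)
qed

lemma coding_map_in_closure:
  assumes "\<sigma> \<in> coding_domain M x"
  shows "coding_map M x \<sigma> \<in> closure (atom M (ter_ext M (\<sigma> 0)))"
  using coding_seq_in_atom coding_seq_tendsto[OF assms] assms
  unfolding closure_sequential coding_domain_def by blast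

text \<open>The approximating points lie in the initial atom of \<open>e\<close>, where \<open>w e\<close> is the map of the edge; in
  the limit the continuity of \<open>w e\<close> on the whole space is used.\<close>

lemma coding_map_shift:
  assumes \<sigma>: "\<sigma> \<in> coding_domain M x" and e: "\<sigma> 1 = Some e"
  shows "coding_map M x (shift \<sigma>) = w e (coding_map M x \<sigma>)"
proof -
  have path: "\<sigma> \<in> path_space M"
    using \<sigma> by (simp add: coding_domain_def)
  then have "\<sigma> 1 \<in> Some ` edges M" "ini_ext M (\<sigma> (0 + 1)) = ter_ext M (\<sigma> 0)"
    unfolding path_space_def by blast+
  then have E: "e \<in> edges M" and ini: "ini M e = ter_ext M (\<sigma> 0)"
    using e by (auto simp: ini_ext_def)
  have "coding_seq M x (shift \<sigma>) (Suc n) = w e (coding_seq M x \<sigma> n)" for n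
    using coding_seq_in_atom[OF path, of n] w_eq[OF E] e ini
    by (simp add: coding_seq_shift wmap_ext_def)
  moreover have "(\<lambda>n. w e (coding_seq M x \<sigma> n)) \<longlonglongrightarrow> w e (coding_map M x \<sigma>)"
    by (rule continuous_on_tendsto_compose[OF w_cont[OF E] coding_seq_tendsto[OF \<sigma>]]) auto
  ultimately have "(\<lambda>n. coding_seq M x (shift \<sigma>) (Suc n)) \<longlonglongrightarrow> w e (coding_map M x \<sigma>)"
    by simp
  then have lim: "coding_seq M x (shift \<sigma>) \<longlonglongrightarrow> w e (coding_map M x \<sigma>)"
    by (rule LIMSEQ_imp_Suc)
  then have "shift \<sigma> \<in> coding_domain M x"
    using shift_path_space[OF path] by (auto simp: coding_domain_def convergent_def)
  then show ?thesis
    using lim coding_seq_tendsto LIMSEQ_unique by blast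
qed


lemma markov_op_eq_nn_integral:
  "markov_op M f y = (\<integral>\<^sup>+ e. ennreal (eprob M e y * f (wmap M e y)) \<partial>count_space (edges M))"
  unfolding markov_op_def by (rule nn_integral_count_space_eq_infsum[OF countable_edges, symmetric])

lemma markov_op_measurable:
  assumes f: "f \<in> borel_measurable borel"
  shows "markov_op M f \<in> borel_measurable borel"
proof -
  interpret sigma_finite_measure "count_space (edges M)"
    by (rule sigma_finite_measure_count_space_countable[OF countable_edges])
  have [measurable]: "(\<lambda>y. ennreal (eprob M e y * f (wmap M e y))) \<in> borel_measurable borel"
    if "e \<in> edges M" for e
  proof -
    have "eprob M e \<in> borel_measurable borel" "wmap M e \<in> borel_measurable borel"
      using M that by (auto simp: countable_markov_system_def)
    note [measurable] = this f
    show ?thesis by measurable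
  qed
  have "(\<lambda>y. \<integral>\<^sup>+ e. ennreal (eprob M e y * f (wmap M e y)) \<partial>count_space (edges M))
      \<in> borel_measurable borel"
    by (intro borel_measurable_nn_integral, subst measurable_pair_swap_iff)
      (auto intro!: measurable_pair_measure_countable1 countable_edges)
  then show ?thesis
    by (simp add: markov_op_eq_nn_integral[abs_def])
qed

text \<open>At a point of \<open>atom M i\<close> the Markov operator sums over the edges that start at \<open>i\<close>, because the
  other probability functions vanish there; then \<open>glue\<close> exchanges \<open>i\<close> for \<open>j\<close>.\<close>

lemma markov_op_on_closure:
  assumes j: "j \<in> vertices M" and y: "y \<in> closure (atom M j)" and f: "\<And>z. 0 \<le> f z"
  shows "markov_op M f y =
    (\<integral>\<^sup>+ e. ennreal (p e y * f (w e y)) \<partial>count_space {e \<in> edges M. ini M e = j})"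
proof -
  have "y \<in> (\<Union>i\<in>vertices M. atom M i)"
    using M by (simp add: countable_markov_system_def borel_partition_def)
  then obtain i where i: "i \<in> vertices M" "y \<in> atom M i"
    by blast
  have zero: "eprob M e y = 0" if "e \<in> edges M" "ini M e \<noteq> i" for e
  proof -
    have "ini M e \<in> vertices M"
      using M that(1) by (auto simp: countable_markov_system_def)
    then have "y \<notin> atom M (ini M e)"
      using M i that(2)
      by (auto simp: countable_markov_system_def borel_partition_def disjoint_family_on_def)
    then show ?thesis
      using M that(1) by (auto simp: countable_markov_system_def)
  qed
  have "markov_op M f y =
      (\<integral>\<^sup>+ e. ennreal (eprob M e y * f (wmap M e y)) \<partial>count_space {e \<in> edges M. ini M e = i})"
    unfolding markov_op_eq_nn_integral by (rule nn_integral_count_space_eq) (auto simp: zero)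
  also have "\<dots> = (\<integral>\<^sup>+ e. ennreal (p e y * f (w e y)) \<partial>count_space {e \<in> edges M. ini M e = i})"
    using i by (intro nn_integral_cong) (auto simp: p_eq w_eq)
  also have "\<dots> = (\<integral>\<^sup>+ e. ennreal (p e y * f (w e y)) \<partial>count_space {e \<in> edges M. ini M e = j})"
    by (rule glue[OF i(1) j i(2) y f])
  finally show ?thesis .
qed

context
  fixes \<Lambda> :: "(int \<Rightarrow> 'e option) measure"
  assumes \<Lambda>: "\<Lambda> \<in> tilde_E M x"
begin

interpretation prob_space \<Lambda>
  using \<Lambda> by (simp add: tilde_E_def shift_invariant_measures_def)

lemma sets_\<Lambda>: "sets \<Lambda> = sets (borel_of_topology (code_top M))"
  using \<Lambda> by (simp add: tilde_E_def shift_invariant_measures_def)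

lemma space_\<Lambda>: "space \<Lambda> = code_space M"
  using sets_eq_imp_space_eq[OF sets_\<Lambda>] by simp

lemma past_subalgebra: "subalgebra \<Lambda> (past_algebra M)"
  using past_algebra_subset_borel by (auto simp: subalgebra_def space_\<Lambda> sets_\<Lambda>)

text \<open>The domain has measure one, and a set that is not measurable would have measure zero.\<close>

lemma coding_domain_measurable [measurable]: "coding_domain M x \<in> sets \<Lambda>"
proof -
  have "measure \<Lambda> (coding_domain M x) = 1"
    using \<Lambda> by (simp add: tilde_E_def)
  then show ?thesis
    using measure_notin_sets[of "coding_domain M x" \<Lambda>] by auto
qed

lemma AE_coding_domain: "AE \<sigma> in \<Lambda>. \<sigma> \<in> coding_domain M x"
  using \<Lambda> by (intro AE_in_set_eq_1[THEN iffD2] coding_domain_measurable) (simp add: tilde_E_def)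

lemma coding_map_measurable [measurable]: "coding_map M x \<in> borel_measurable \<Lambda>"
proof -
  have [measurable]: "past_limit M x \<in> borel_measurable \<Lambda>"
    by (rule measurable_from_subalg[OF past_subalgebra past_limit_measurable[OF countable_edges]])
  have [measurable]: "(\<lambda>\<sigma>. x (ter_ext M (\<sigma> 0))) \<in> borel_measurable \<Lambda>"
    by (rule measurable_from_subalg[OF past_subalgebra past_measurable[OF countable_edges, of 0]]) auto
  have "(\<lambda>\<sigma>. if \<sigma> \<in> coding_domain M x then past_limit M x \<sigma> else x (ter_ext M (\<sigma> 0)))
      \<in> borel_measurable \<Lambda>"
    by measurable
  also have "(\<lambda>\<sigma>. if \<sigma> \<in> coding_domain M x then past_limit M x \<sigma> else x (ter_ext M (\<sigma> 0))) = coding_map M x"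
    by (auto simp: coding_map_def past_limit_def coding_domain_def)
  finally show ?thesis .
qed

text \<open>The point \<open>past_limit M x \<sigma>\<close> is a function of the past, so in the integral the event that the
  next letter is \<open>e\<close> may be replaced by its conditional probability. Since \<open>coding_map M x \<sigma>\<close> lies in
  the closure of the atom in which \<open>\<sigma>\<close> ends, this probability is given by \<open>p e\<close>.\<close>

lemma nn_integral_edge:
  assumes e: "e \<in> edges M" and f: "f \<in> borel_measurable borel" "\<And>z. 0 \<le> f z" "\<And>z. f z \<le> B"
  shows "(\<integral>\<^sup>+ \<sigma>. ennreal (f (w e (past_limit M x \<sigma>)) * indicator (cylinder M 1 1 (\<lambda>_. Some e)) \<sigma>) \<partial>\<Lambda>) =
    (\<integral>\<^sup>+ \<sigma>. ennreal (f (w e (past_limit M x \<sigma>)) *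
      (p e (past_limit M x \<sigma>) * indicator {\<sigma>. ter_ext M (\<sigma> 0) = ini M e} \<sigma>)) \<partial>\<Lambda>)"
proof -
  interpret finite_measure_subalgebra \<Lambda> "past_algebra M"
    by unfold_locales (rule past_subalgebra)
  let ?h = "\<lambda>\<sigma>. f (w e (past_limit M x \<sigma>))"
  let ?C = "cylinder M 1 1 (\<lambda>_. Some e)"
  let ?c = "real_cond_exp \<Lambda> (past_algebra M) (indicator ?C)"
  have [measurable]: "w e \<in> borel_measurable borel"
    by (intro borel_measurable_continuous_onI w_cont e)
  note [measurable] = f(1) past_limit_measurable[OF countable_edges, of x]
  have h: "?h \<in> borel_measurable (past_algebra M)"
    by measurable
  note [measurable] = measurable_from_subalg[OF past_subalgebra h]
  have C [measurable]: "?C \<in> sets \<Lambda>"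
    using e by (auto simp: sets_\<Lambda> intro!: cylinder_borel)
  have int: "integrable \<Lambda> (\<lambda>\<sigma>. ?h \<sigma> * indicator ?C \<sigma>)"
  proof (rule integrable_const_bound[where B = B])
    have "0 \<le> B"
      using f(2,3) order_trans by blast
    then show "AE \<sigma> in \<Lambda>. norm (?h \<sigma> * indicator ?C \<sigma>) \<le> B"
      using f(2,3) by (intro AE_I2) (simp add: indicator_def)
  qed measurable
  note cond = real_cond_exp_intg[OF int h borel_measurable_indicator[OF C]]
  have pos: "AE \<sigma> in \<Lambda>. 0 \<le> ?c \<sigma>"
    by (rule real_cond_exp_pos) auto
  have "(\<integral>\<^sup>+ \<sigma>. ennreal (?h \<sigma> * indicator ?C \<sigma>) \<partial>\<Lambda>) = ennreal (\<integral>\<sigma>. ?h \<sigma> * indicator ?C \<sigma> \<partial>\<Lambda>)"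
    using f(2) by (intro nn_integral_eq_integral int) simp
  also have "\<dots> = ennreal (\<integral>\<sigma>. ?h \<sigma> * ?c \<sigma> \<partial>\<Lambda>)"
    by (simp add: cond(2))
  also have "\<dots> = (\<integral>\<^sup>+ \<sigma>. ennreal (?h \<sigma> * ?c \<sigma>) \<partial>\<Lambda>)"
    using f(2) pos by (intro nn_integral_eq_integral[symmetric] cond(1)) auto
  also have "\<dots> = (\<integral>\<^sup>+ \<sigma>. ennreal (?h \<sigma> *
      (p e (past_limit M x \<sigma>) * indicator {\<sigma>. ter_ext M (\<sigma> 0) = ini M e} \<sigma>)) \<partial>\<Lambda>)"
  proof (rule nn_integral_cong_AE)
    have "AE \<sigma> in \<Lambda>. ?c \<sigma> = eprob_bar M e (coding_map M x \<sigma>) * indicator (ending_in M (ini M e)) \<sigma>"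
      using \<Lambda> e by (simp add: tilde_E_def)
    then show "AE \<sigma> in \<Lambda>. ennreal (?h \<sigma> * ?c \<sigma>) = ennreal (?h \<sigma> *
        (p e (past_limit M x \<sigma>) * indicator {\<sigma>. ter_ext M (\<sigma> 0) = ini M e} \<sigma>))"
      using AE_coding_domain
    proof eventually_elim
      case (elim \<sigma>)
      have "\<sigma> \<in> path_space M"
        using elim(2) by (simp add: coding_domain_def)
      then have "?c \<sigma> = p e (past_limit M x \<sigma>) * indicator {\<sigma>. ter_ext M (\<sigma> 0) = ini M e} \<sigma>"
        using elim(1) coding_map_in_closure[OF elim(2)] coding_map_eq_past_limit[OF elim(2)]
        by (auto simp: eprob_bar_eq[OF e] ending_in_def indicator_def)
      then show ?case by simp
    qed
  qed
  finally show ?thesis .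
qed

text \<open>Shift invariance, a decomposition according to the letter at position 1, and conditioning on
  the past turn the integral of \<open>f\<close> at the coding map into that of \<open>markov_op M f\<close>.\<close>

lemma nn_integral_coding_map:
  assumes f: "f \<in> borel_measurable borel" "\<And>z. 0 \<le> f z" "\<And>z. f z \<le> B"
  shows "(\<integral>\<^sup>+ \<sigma>. ennreal (f (coding_map M x \<sigma>)) \<partial>\<Lambda>) = (\<integral>\<^sup>+ \<sigma>. markov_op M f (coding_map M x \<sigma>) \<partial>\<Lambda>)"
proof -
  let ?G = "past_limit M x"
  let ?C = "\<lambda>e. cylinder M 1 1 (\<lambda>_. Some e)"
  let ?T = "\<lambda>e. {\<sigma>. ter_ext M (\<sigma> 0) = ini M e}"
  note [measurable] = f(1)
  have G [measurable]: "?G \<in> borel_measurable \<Lambda>"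
    by (rule measurable_from_subalg[OF past_subalgebra past_limit_measurable[OF countable_edges]])
  have w [measurable]: "w e \<in> borel_measurable borel" and p [measurable]: "p e \<in> borel_measurable borel"
    if "e \<in> edges M" for e
    using that by (auto intro!: borel_measurable_continuous_onI w_cont p_cont)
  have C [measurable]: "?C e \<in> sets \<Lambda>" if "e \<in> edges M" for e
    using that by (auto simp: sets_\<Lambda> intro!: cylinder_borel)
  have T [measurable]: "(indicator (?T e) :: _ \<Rightarrow> real) \<in> borel_measurable \<Lambda>" for e
    by (rule measurable_from_subalg[OF past_subalgebra past_measurable[OF countable_edges, of 0]])
      (auto simp: indicator_def)
  have shift: "shift \<in> measurable \<Lambda> \<Lambda>" "distr \<Lambda> \<Lambda> shift = \<Lambda>"
    using shift_measurable[of M] \<Lambda> measurable_cong_sets[OF sets_\<Lambda> sets_\<Lambda>]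
    by (auto simp: tilde_E_def shift_invariant_measures_def)
  have "(\<integral>\<^sup>+ \<sigma>. ennreal (f (coding_map M x \<sigma>)) \<partial>\<Lambda>) =
      (\<integral>\<^sup>+ \<sigma>. ennreal (f (coding_map M x \<sigma>)) \<partial>distr \<Lambda> \<Lambda> shift)"
    by (simp add: shift(2))
  also have "\<dots> = (\<integral>\<^sup>+ \<sigma>. ennreal (f (coding_map M x (shift \<sigma>))) \<partial>\<Lambda>)"
    by (rule nn_integral_distr[OF shift(1)]) measurable
  also have "\<dots> = (\<integral>\<^sup>+ \<sigma>. \<integral>\<^sup>+ e. ennreal (f (w e (?G \<sigma>)) * indicator (?C e) \<sigma>) \<partial>count_space (edges M) \<partial>\<Lambda>)"
  proof (rule nn_integral_cong_AE, use AE_coding_domain in eventually_elim)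
    case (elim \<sigma>)
    then have \<sigma>: "\<sigma> \<in> code_space M" and "\<sigma> 1 \<in> Some ` edges M"
      unfolding coding_domain_def path_space_def by blast+
    then obtain e where e: "e \<in> edges M" "\<sigma> 1 = Some e"
      by blast
    \<comment> \<open>Only the edge at position 1 contributes to the sum.\<close>
    have "(\<integral>\<^sup>+ e. ennreal (f (w e (?G \<sigma>)) * indicator (?C e) \<sigma>) \<partial>count_space (edges M)) =
        (\<integral>\<^sup>+ e. ennreal (f (w e (?G \<sigma>)) * indicator (?C e) \<sigma>) \<partial>count_space {e})"
      using e by (intro nn_integral_count_space_eq) (auto simp: cylinder_def indicator_def)
    also have "\<dots> = ennreal (f (w e (?G \<sigma>)))"
      using e \<sigma> by (simp add: nn_integral_count_space_finite cylinder_def)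
    finally show ?case
      using coding_map_shift[OF elim e(2)] coding_map_eq_past_limit[OF elim] by simp
  qed
  also have "\<dots> = (\<integral>\<^sup>+ e. \<integral>\<^sup>+ \<sigma>. ennreal (f (w e (?G \<sigma>)) * indicator (?C e) \<sigma>) \<partial>\<Lambda> \<partial>count_space (edges M))"
    by (intro nn_integral_count_space_nn_integral countable_edges) measurable
  also have "\<dots> = (\<integral>\<^sup>+ e. \<integral>\<^sup>+ \<sigma>. ennreal (f (w e (?G \<sigma>)) * (p e (?G \<sigma>) * indicator (?T e) \<sigma>)) \<partial>\<Lambda>
      \<partial>count_space (edges M))"
    using nn_integral_edge[OF _ f] by (rule nn_integral_cong) simp
  also have "\<dots> = (\<integral>\<^sup>+ \<sigma>. \<integral>\<^sup>+ e. ennreal (f (w e (?G \<sigma>)) * (p e (?G \<sigma>) * indicator (?T e) \<sigma>))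
      \<partial>count_space (edges M) \<partial>\<Lambda>)"
    by (intro nn_integral_count_space_nn_integral[symmetric] countable_edges) measurable
  also have "\<dots> = (\<integral>\<^sup>+ \<sigma>. markov_op M f (coding_map M x \<sigma>) \<partial>\<Lambda>)"
  proof (rule nn_integral_cong_AE, use AE_coding_domain in eventually_elim)
    case (elim \<sigma>)
    let ?j = "ter_ext M (\<sigma> 0)"
    have "\<sigma> 0 \<in> Some ` edges M"
      using elim unfolding coding_domain_def path_space_def by blast
    then have j: "?j \<in> vertices M"
      using M by (auto simp: ter_ext_def countable_markov_system_def)
    have "(\<integral>\<^sup>+ e. ennreal (f (w e (?G \<sigma>)) * (p e (?G \<sigma>) * indicator (?T e) \<sigma>)) \<partial>count_space (edges M)) =
        (\<integral>\<^sup>+ e. ennreal (f (w e (?G \<sigma>)) * (p e (?G \<sigma>) * indicator (?T e) \<sigma>))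
          \<partial>count_space {e \<in> edges M. ini M e = ?j})"
      by (rule nn_integral_count_space_eq) (auto simp: indicator_def)
    also have "\<dots> = (\<integral>\<^sup>+ e. ennreal (p e (?G \<sigma>) * f (w e (?G \<sigma>)))
          \<partial>count_space {e \<in> edges M. ini M e = ?j})"
      by (rule nn_integral_cong) (auto simp: mult.commute)
    also have "\<dots> = markov_op M f (coding_map M x \<sigma>)"
      using markov_op_on_closure[OF j coding_map_in_closure[OF elim], of f] f(2)
      by (simp add: coding_map_eq_past_limit[OF elim])
    finally show ?case .
  qed
  finally show ?thesis .
qed

lemma distr_coding_map_invariant: "distr \<Lambda> borel (coding_map M x) \<in> invariant_measures M"
  unfolding invariant_measures_def
proof (intro CollectI conjI ballI impI)
  show "prob_space (distr \<Lambda> borel (coding_map M x))"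
    by (rule prob_space_distr) measurable
  fix f :: "'k \<Rightarrow> real"
  assume f [measurable]: "f \<in> borel_measurable borel" and *: "(\<forall>z. 0 \<le> f z) \<and> bounded (range f)"
  then obtain B where B: "\<And>z. f z \<le> B"
    unfolding bounded_iff by (metis abs_le_D1 range_eqI real_norm_def)
  have "markov_adj M (distr \<Lambda> borel (coding_map M x)) f = (\<integral>\<^sup>+ \<sigma>. markov_op M f (coding_map M x \<sigma>) \<partial>\<Lambda>)"
    unfolding markov_adj_def using markov_op_measurable[OF f] by (intro nn_integral_distr) auto
  also have "\<dots> = (\<integral>\<^sup>+ \<sigma>. ennreal (f (coding_map M x \<sigma>)) \<partial>\<Lambda>)"
    using * B by (intro nn_integral_coding_map[symmetric] f) auto
  also have "\<dots> = (\<integral>\<^sup>+ y. ennreal (f y) \<partial>distr \<Lambda> borel (coding_map M x))"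
    by (rule nn_integral_distr[symmetric]) measurable
  finally show "markov_adj M (distr \<Lambda> borel (coding_map M x)) f =
      (\<integral>\<^sup>+ y. ennreal (f y) \<partial>distr \<Lambda> borel (coding_map M x))" .
qed simp

end

end

section \<open>Markov partitions of continuous random dynamical systems\<close>

text \<open>The edges at \<open>j\<close> correspond to the indices whose probability function does not vanish
  identically on \<open>K j\<close>. The remaining indices contribute nothing, since by continuity their
  probability functions also vanish on the closure. The right-hand side does not depend on \<open>j\<close>.\<close>

lemma resulting_sum_on_closure:
  fixes f :: "'k::metric_space \<Rightarrow> real"
  assumes R: "continuous_rds R" and j: "j \<in> N"
    and \<phi>: "bij_betw \<phi> (edges M) {(e', j). e' \<in> rds_index R \<and> j \<in> N \<and> (\<exists>x\<in>K j. rds_prob R e' x \<noteq> 0)}"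
    and ini: "\<And>e. e \<in> edges M \<Longrightarrow> ini M e = snd (\<phi> e)"
    and y: "y \<in> closure (K j)"
  shows "(\<integral>\<^sup>+ e. ennreal (rds_prob R (fst (\<phi> e)) y * f (rds_map R (fst (\<phi> e)) y))
      \<partial>count_space {e \<in> edges M. ini M e = j}) =
    (\<integral>\<^sup>+ e'. ennreal (rds_prob R e' y * f (rds_map R e' y)) \<partial>count_space (rds_index R))"
proof -
  let ?A = "{e' \<in> rds_index R. \<exists>x\<in>K j. rds_prob R e' x \<noteq> 0}"
  have "bij_betw (\<lambda>e. fst (\<phi> e)) {e \<in> edges M. ini M e = j} ?A"
  proof (rule bij_betw_imageI)
    have inj: "inj_on \<phi> (edges M)" and img: "\<phi> ` edges M = {(e', j). e' \<in> rds_index R \<and> j \<in> N \<and> (\<exists>x\<in>K j. rds_prob R e' x \<noteq> 0)}"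
      using \<phi> by (auto simp: bij_betw_def)
    show "inj_on (\<lambda>e. fst (\<phi> e)) {e \<in> edges M. ini M e = j}"
    proof (rule inj_onI)
      fix d e
      assume *: "d \<in> {e \<in> edges M. ini M e = j}" "e \<in> {e \<in> edges M. ini M e = j}"
        and "fst (\<phi> d) = fst (\<phi> e)"
      then have "\<phi> d = \<phi> e"
        using ini[of d] ini[of e] by (simp add: prod_eq_iff)
      then show "d = e"
        using * inj by (simp add: inj_on_eq_iff)
    qed
    show "(\<lambda>e. fst (\<phi> e)) ` {e \<in> edges M. ini M e = j} = ?A"
    proof (intro equalityI subsetI)
      fix e' assume "e' \<in> (\<lambda>e. fst (\<phi> e)) ` {e \<in> edges M. ini M e = j}"
      then obtain e where e: "e \<in> edges M" "ini M e = j" "e' = fst (\<phi> e)"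
        by auto
      then have "\<phi> e = (e', j)" "\<phi> e \<in> \<phi> ` edges M"
        using ini by (auto simp: prod_eq_iff)
      then show "e' \<in> ?A"
        unfolding img by auto
    next
      fix e' assume "e' \<in> ?A"
      then have "(e', j) \<in> \<phi> ` edges M"
        unfolding img using j by auto
      then obtain e where "e \<in> edges M" "\<phi> e = (e', j)"
        unfolding image_iff by metis
      then show "e' \<in> (\<lambda>e. fst (\<phi> e)) ` {e \<in> edges M. ini M e = j}"
        using ini[of e] by (intro image_eqI[of _ _ e]) simp_all
    qed
  qed
  then have "(\<integral>\<^sup>+ e. ennreal (rds_prob R (fst (\<phi> e)) y * f (rds_map R (fst (\<phi> e)) y))
      \<partial>count_space {e \<in> edges M. ini M e = j}) =
    (\<integral>\<^sup>+ e'. ennreal (rds_prob R e' y * f (rds_map R e' y)) \<partial>count_space ?A)"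
    by (rule nn_integral_bij_count_space)
  also have "\<dots> = (\<integral>\<^sup>+ e'. ennreal (rds_prob R e' y * f (rds_map R e' y)) \<partial>count_space (rds_index R))"
  proof (rule nn_integral_count_space_eq)
    fix e' assume e': "e' \<in> rds_index R - ?A"
    then have "continuous_on UNIV (rds_prob R e')"
      using R by (simp add: continuous_rds_def)
    then have "continuous_on (closure (K j)) (rds_prob R e')"
      by (rule continuous_on_subset) simp
    then have "rds_prob R e' y = 0"
      by (rule continuous_constant_on_closure) (use e' y in auto)
    then show "ennreal (rds_prob R e' y * f (rds_map R e' y)) = 0"
      by simp
  qed auto
  finally show ?thesis .
qed

theorem theorem4:
  fixes R :: "('i, 'k::complete_space) rds"
    and N :: "nat set"
    and K :: "nat \<Rightarrow> 'k set"
    and M :: "('e, 'k) markov_system"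
    and x :: "nat \<Rightarrow> 'k"
  assumes "random_dynamical_system R"
    and "markov_partition R N K"
    and "resulting_markov_system R N K M"
    and "countable_markov_system M"
    and "continuous_rds R"
    and "uniformly_continuous_ms M"
    and "has_dominating_markov_chain M"
    and "\<forall>j\<in>N. x j \<in> K j"
  shows "consistent M x"
proof -
  note resulting = assms(3)[unfolded resulting_markov_system_def]
  have N: "vertices M = N" and K: "\<And>j. j \<in> N \<Longrightarrow> atom M j = K j"
    using resulting by simp_all
  obtain \<phi> where
    \<phi>: "bij_betw \<phi> (edges M) {(e', j). e' \<in> rds_index R \<and> j \<in> N \<and> (\<exists>x\<in>K j. rds_prob R e' x \<noteq> 0)}"
    and restr: "\<forall>e\<in>edges M. \<forall>e' j. \<phi> e = (e', j) \<longrightarrow> ini M e = j \<and>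
        (\<forall>x\<in>K j. wmap M e x = rds_map R e' x) \<and> (\<forall>x\<in>K j. eprob M e x = rds_prob R e' x) \<and>
        rds_map R e' ` K j \<subseteq> K (ter M e)"
    using resulting by (elim conjE exE)
  have index: "fst (\<phi> e) \<in> rds_index R" "ini M e = snd (\<phi> e)" "ini M e \<in> N"
    and eq: "\<And>y. y \<in> K (ini M e) \<Longrightarrow> rds_map R (fst (\<phi> e)) y = wmap M e y"
      "\<And>y. y \<in> K (ini M e) \<Longrightarrow> rds_prob R (fst (\<phi> e)) y = eprob M e y"
    if e: "e \<in> edges M" for e
  proof -
    note pair = bspec[OF bij_betwE[OF \<phi>] e, unfolded case_prod_beta mem_Collect_eq]
    have "\<phi> e = (fst (\<phi> e), snd (\<phi> e))"
      by simp
    from restr[THEN bspec, OF e, THEN spec, THEN spec, THEN mp, OF this]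
    have ini: "ini M e = snd (\<phi> e)"
      and w: "\<forall>y\<in>K (snd (\<phi> e)). wmap M e y = rds_map R (fst (\<phi> e)) y"
      and p: "\<forall>y\<in>K (snd (\<phi> e)). eprob M e y = rds_prob R (fst (\<phi> e)) y"
      by simp_all
    show "fst (\<phi> e) \<in> rds_index R"
      using pair by (rule conjunct1)
    show "ini M e = snd (\<phi> e)"
      by (rule ini)
    show "ini M e \<in> N"
      unfolding ini using pair by (elim conjE)
    fix y assume "y \<in> K (ini M e)"
    then have y: "y \<in> K (snd (\<phi> e))"
      by (simp only: ini)
    show "rds_map R (fst (\<phi> e)) y = wmap M e y" "rds_prob R (fst (\<phi> e)) y = eprob M e y"
      using bspec[OF w y] bspec[OF p y] by (simp_all only:)
  qed
  interpret continuously_extended M x "\<lambda>e. rds_map R (fst (\<phi> e))" "\<lambda>e. rds_prob R (fst (\<phi> e))"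
  proof
    show "x j \<in> atom M j" if "j \<in> vertices M" for j
      using assms(8) that N K by simp
    show "continuous_on UNIV (rds_map R (fst (\<phi> e)))" "continuous_on UNIV (rds_prob R (fst (\<phi> e)))"
      if "e \<in> edges M" for e
      using assms(5) index(1)[OF that] by (auto simp: continuous_rds_def)
    show "rds_map R (fst (\<phi> e)) y = wmap M e y" "rds_prob R (fst (\<phi> e)) y = eprob M e y"
      if "e \<in> edges M" "y \<in> atom M (ini M e)" for e y
      using eq[OF that(1), of y] that(2) K[OF index(3)[OF that(1)]] by simp_all
    fix i j y and f :: "'k \<Rightarrow> real"
    assume ij: "i \<in> vertices M" "j \<in> vertices M" and y: "y \<in> atom M i" "y \<in> closure (atom M j)"
    have i: "i \<in> N" and j: "j \<in> N"
      using ij by (simp_all add: N)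
    have "y \<in> closure (K i)" and "y \<in> closure (K j)"
      using y closure_subset[of "K i"] by (auto simp: K[OF i] K[OF j])
    note on_closure = resulting_sum_on_closure[where f = f, OF assms(5) i \<phi> index(2) this(1)]
      resulting_sum_on_closure[where f = f, OF assms(5) j \<phi> index(2) this(2)]
    show "(\<integral>\<^sup>+ e. ennreal (rds_prob R (fst (\<phi> e)) y * f (rds_map R (fst (\<phi> e)) y))
          \<partial>count_space {e \<in> edges M. ini M e = i}) =
        (\<integral>\<^sup>+ e. ennreal (rds_prob R (fst (\<phi> e)) y * f (rds_map R (fst (\<phi> e)) y))
          \<partial>count_space {e \<in> edges M. ini M e = j})"
      by (rule trans[OF on_closure(1) on_closure(2)[symmetric]])
  qed (rule assms(4))
  show ?thesis
    unfolding consistent_def by (intro ballI distr_coding_map_invariant)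
qed

end
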